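(* (Minkowski's inequality.) Let $\mathbb{T}$ be a time scale and let $a,b\in\mathbb{T}$ with $a<b$. Let $h\in C_{rd}([a,b]_{\mathbb{T}},\mathbb{R})$, $f,g\in C([a,b]_{\mathbb{T}},\mathbb{R}_{\mathcal{I}}^{+})$ and $p>1$. Then $$\bigg(\int_a^b|h(s)|(f(s)+g(s))^{p}\Delta s\bigg)^{\frac1p}\le\bigg(\int_a^b|h(s)|f^{p}(s)\Delta s\bigg)^{\frac1p}+\bigg(\int_a^b|h(s)|g^{p}(s)\Delta s\bigg)^{\frac1p},$$ where the integrals are $IR$ $\Delta$-integrals of interval-valued functions and $\le$ is the partial order on intervals.
   Context: A time scale $\mathbb{T}$ is a nonempty closed subset of $\mathbb{R}$. For $a,b\in\mathbb{T}$, $[a,b]_{\mathbb{T}}=\{t\in\mathbb{T}:a\le t\le b\}$ and $[a,b)_{\mathbb{T}}=\{t\in\mathbb{T}:a\le t<b\}$. Put $\sigma(t)=\inf\{s\in\mathbb{T}:s>t\}$ and $\rho(t)=\sup\{s\in\mathbb{T}:s<t\}$ (with $\sigma(\sup\mathbb{T})=\sup\mathbb{T}$, $\rho(\inf\mathbb{T})=\inf\mathbb{T}$ when finite). A point $t$ is right-dense if $\sigma(t)=t<\sup\mathbb{T}$ and left-dense if $\rho(t)=t>\inf\mathbb{T}$. $C_{rd}([a,b]_{\mathbb{T}},\mathbb{R})$ is the set of $rd$-continuous functions $[a,b]_{\mathbb{T}}\to\mathbb{R}$: right continuous at each right-dense point, with a finite left limit at each left-dense point. $\mathbb{R}_{\mathcal{I}}$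 is the set of nonempty compact intervals $[\underline{u},\overline{u}]\subset\mathbb{R}$, $\underline{u}\le\overline{u}$ (degenerate intervals allowed); $\mathbb{R}^+_{\mathcal{I}}$ is the subset with $\underline{u}>0$. The metric is $d([\underline{u},\overline{u}],[\underline{v},\overline{v}])=\max\{|\underline{u}-\underline{v}|,|\overline{u}-\overline{v}|\}$; $C([a,b]_{\mathbb{T}},X)$, $X\subseteq\mathbb{R}_{\mathcal{I}}$, is the set of functions $[a,b]_{\mathbb{T}}\to X$ continuous for this metric. Partial order: $[\underline{u},\overline{u}]\le[\underline{v},\overline{v}]$ iff $\underline{u}\le\underline{v}$ and $\overline{u}\le\overline{v}$. Operations: $[\underline{u},\overline{u}]+[\underline{v},\overline{v}]=[\underline{u}+\underline{v},\overline{u}+\overline{v}]$; $\lambda[\underline{u},\overline{u}]=[\lambda\underline{u},\lambda\overline{u}]$ for $\lambda>0$ and $0\cdot[\underline{u},\overline{u}]=\{0\}$; for $\underline{u}\ge0$ and real $r>0$, $[\underline{u},\overline{u}]^r=[\underline{u}^r,\overline{u}^r]$. Operations on functions are pointwise. A division of $[a,b]_{\mathbb{T}}$ is a finite set $D=\{a=t_0<\cdots<t_n=b\}\subseteq[a,b]_{\mathbb{T}}$. For $\delta>0$, $\mathcal{D}(\delta,[a,b]_{\mathbb{T}})$ is the (nonempty) set of divisions such that for each $i$ either $t_i-t_{i-1}\le\delta$, or $t_i-t_{i-1}>\delta$ and $\rho(t_i)=t_{i-1}$. A Riemann $\Delta$-sum of $F:[a,b]_{\mathbb{T}}\to\mathbb{R}_{\mathcal{I}}$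 is $S(F,D,\delta)=\sum_{i=1}^nF(\xi_i)(t_i-t_{i-1})$ with $D\in\mathcal{D}(\delta,[a,b]_{\mathbb{T}})$ and arbitrary $\xi_i\in[t_{i-1},t_i)_{\mathbb{T}}$. $F$ is $IR$ $\Delta$-integrable with integral $A=(IR)\int_a^bF(t)\Delta t\in\mathbb{R}_{\mathcal{I}}$ (written here $\int_a^bF(t)\Delta t$) if for every $\epsilon>0$ there is $\delta>0$ with $d(S(F,D,\delta),A)<\epsilon$ for all $D\in\mathcal{D}(\delta,[a,b]_{\mathbb{T}})$ and all choices of $\xi_i$. *)

theory Defs
  imports "HOL-Analysis.Analysis" "HOL-Library.Interval"
begin

section \<open>Time scales\<close>

definition time_scale :: "real set \<Rightarrow> bool" where
  "time_scale T \<longleftrightarrow> T \<noteq> {} \<and> closed T"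

definition ts_Icc :: "real set \<Rightarrow> real \<Rightarrow> real \<Rightarrow> real set" where
  "ts_Icc T a b = {t \<in> T. a \<le> t \<and> t \<le> b}"

definition ts_Ico :: "real set \<Rightarrow> real \<Rightarrow> real \<Rightarrow> real set" where
  "ts_Ico T a b = {t \<in> T. a \<le> t \<and> t < b}"

text \<open>Since \<open>T\<close> may be unbounded, the condition \<open>t < sup T\<close> (with a possibly infinite
  supremum) is written as the existence of a point of \<open>T\<close> above \<open>t\<close>; dually for \<open>inf T\<close>.\<close>

definition ts_sigma :: "real set \<Rightarrow> real \<Rightarrow> real" where
  "ts_sigma T t = (if \<exists>s\<in>T. t < s then Inf {s \<in> T. t < s} else t)"

definition ts_rho :: "real set \<Rightarrow> real \<Rightarrow> real" where
  "ts_rho T t = (if \<exists>s\<in>T. s < t then Sup {s \<in> T. s < t} else t)"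

definition right_dense :: "real set \<Rightarrow> real \<Rightarrow> bool" where
  "right_dense T t \<longleftrightarrow> ts_sigma T t = t \<and> (\<exists>s\<in>T. t < s)"

definition left_dense :: "real set \<Rightarrow> real \<Rightarrow> bool" where
  "left_dense T t \<longleftrightarrow> ts_rho T t = t \<and> (\<exists>s\<in>T. s < t)"

text \<open>Functions on \<open>[a,b]\<close> intersected with \<open>T\<close> are total functions of which only the values on
  that set matter. One-sided limits are taken within that set, so the right-continuity
  condition at \<open>b\<close> and the left-limit condition at \<open>a\<close> hold vacuously.\<close>

definition C_rd :: "real set \<Rightarrow> real \<Rightarrow> real \<Rightarrow> (real \<Rightarrow> real) set" where
  "C_rd T a b = {h. \<forall>t\<in>ts_Icc T a b.
     (right_dense T t \<longrightarrow> (h \<longlongrightarrow> h t) (at t within (ts_Icc T a b \<inter> {t<..}))) \<and>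
     (left_dense T t \<longrightarrow> (\<exists>L. (h \<longlongrightarrow> L) (at t within (ts_Icc T a b \<inter> {..<t}))))}"


section \<open>Interval arithmetic\<close>

text \<open>The library order \<open>\<le>\<close> on \<^typ>\<open>real interval\<close> is inclusion, so the
  endpointwise order needs its own symbol. Addition is the library's.\<close>

definition interval_le :: "real interval \<Rightarrow> real interval \<Rightarrow> bool" (infix "\<le>\<^sub>I" 50) where
  "u \<le>\<^sub>I v \<longleftrightarrow> lower u \<le> lower v \<and> upper u \<le> upper v"

definition interval_dist :: "real interval \<Rightarrow> real interval \<Rightarrow> real" where
  "interval_dist u v = max \<bar>lower u - lower v\<bar> \<bar>upper u - upper v\<bar>"

definition pos_intervals :: "real interval set" where
  "pos_intervals = {u. 0 < lower u}"

text \<open>Scaling is only meant for a nonnegative factor, and powers only for intervals with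
  nonnegative lower endpoint and a positive exponent, as in the lemmas below.\<close>

definition interval_scale :: "real \<Rightarrow> real interval \<Rightarrow> real interval" where
  "interval_scale c u = Interval (c * lower u, c * upper u)"

definition interval_powr :: "real interval \<Rightarrow> real \<Rightarrow> real interval" where
  "interval_powr u r = Interval (lower u powr r, upper u powr r)"

lemma bounds_Interval:
  fixes x y :: real
  assumes "x \<le> y"
  shows "lower (Interval (x, y)) = x" "upper (Interval (x, y)) = y"
  using assms by (simp_all add: lower.rep_eq upper.rep_eq Interval_inverse)

lemma bounds_interval_scale:
  assumes "0 \<le> c"
  shows "lower (interval_scale c u) = c * lower u" "upper (interval_scale c u) = c * upper u"
  using assms by (simp_all add: interval_scale_def bounds_Interval mult_left_mono)

lemma bounds_interval_powr:
  assumes "0 \<le> lower u" "0 < r"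
  shows "lower (interval_powr u r) = lower u powr r" "upper (interval_powr u r) = upper u powr r"
  using assms by (simp_all add: interval_powr_def bounds_Interval powr_mono2)

definition C_interval ::
    "real set \<Rightarrow> real \<Rightarrow> real \<Rightarrow> real interval set \<Rightarrow> (real \<Rightarrow> real interval) set" where
  "C_interval T a b X = {f. (\<forall>t\<in>ts_Icc T a b. f t \<in> X) \<and>
     (\<forall>t\<in>ts_Icc T a b. \<forall>\<epsilon>>0. \<exists>\<delta>>0. \<forall>s\<in>ts_Icc T a b.
        \<bar>s - t\<bar> < \<delta> \<longrightarrow> interval_dist (f s) (f t) < \<epsilon>)}"


section \<open>The interval Riemann delta-integral\<close>

text \<open>A division is given by \<open>n\<close> and its increasing enumeration \<open>t 0 < \<dots> < t n\<close>.\<close>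

definition ts_division ::
    "real set \<Rightarrow> real \<Rightarrow> real \<Rightarrow> nat \<Rightarrow> (nat \<Rightarrow> real) \<Rightarrow> bool" where
  "ts_division T a b n t \<longleftrightarrow>
     t 0 = a \<and> t n = b \<and> (\<forall>i<n. t i < t (Suc i)) \<and> (\<forall>i\<le>n. t i \<in> ts_Icc T a b)"

definition fine_division ::
    "real \<Rightarrow> real set \<Rightarrow> real \<Rightarrow> real \<Rightarrow> nat \<Rightarrow> (nat \<Rightarrow> real) \<Rightarrow> bool" where
  "fine_division \<delta> T a b n t \<longleftrightarrow> ts_division T a b n t \<and>
     (\<forall>i<n. t (Suc i) - t i \<le> \<delta> \<or> (t (Suc i) - t i > \<delta> \<and> ts_rho T (t (Suc i)) = t i))"

definition riemann_delta_sum ::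
    "(real \<Rightarrow> real interval) \<Rightarrow> nat \<Rightarrow> (nat \<Rightarrow> real) \<Rightarrow> (nat \<Rightarrow> real) \<Rightarrow> real interval" where
  "riemann_delta_sum F n t \<xi> = (\<Sum>i<n. interval_scale (t (Suc i) - t i) (F (\<xi> i)))"

definition has_IR_integral ::
    "real set \<Rightarrow> real \<Rightarrow> real \<Rightarrow> (real \<Rightarrow> real interval) \<Rightarrow> real interval \<Rightarrow> bool" where
  "has_IR_integral T a b F A \<longleftrightarrow>
     (\<forall>\<epsilon>>0. \<exists>\<delta>>0. \<forall>n t \<xi>. fine_division \<delta> T a b n t \<longrightarrow>
        (\<forall>i<n. \<xi> i \<in> ts_Ico T (t i) (t (Suc i))) \<longrightarrow>
        interval_dist (riemann_delta_sum F n t \<xi>) A < \<epsilon>)"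

definition IR_integrable ::
    "real set \<Rightarrow> real \<Rightarrow> real \<Rightarrow> (real \<Rightarrow> real interval) \<Rightarrow> bool" where
  "IR_integrable T a b F \<longleftrightarrow> (\<exists>A. has_IR_integral T a b F A)"

definition IR_integral ::
    "real set \<Rightarrow> real \<Rightarrow> real \<Rightarrow> (real \<Rightarrow> real interval) \<Rightarrow> real interval" where
  "IR_integral T a b F = (THE A. has_IR_integral T a b F A)"

end

theory Submission
  imports Defs
begin

text \<open>
The inequality is Minkowski's inequality for each of the two endpoint functions. Riemann sums, the
metric, powers and scaling by \<open>\<bar>h s\<bar>\<close> all act on lower and upper endpoints
separately (intervals are positive), so it suffices to understand real delta-integrals of
\<open>\<bar>h s\<bar> * k s powr p\<close> with \<open>h\<close> rd-continuous and \<open>k\<close> continuous and positive. Such a product is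
again rd-continuous.

The integrals exist and are well behaved because a delta-integral is an ordinary integral over
\<open>[a,b]\<close>: extend the integrand constantly across each gap of the time scale, from the left
end of the gap. A Riemann delta-sum is the integral of a step function, and as the mesh tends to \<open>0\<close> these
step functions converge to the extended integrand, except possibly at \<open>b\<close> and at the discontinuities
of the integrand on the time scale (\<open>step_function_near_last_point\<close>). An rd-continuous function is bounded
(\<open>C_rd_bounded\<close>) and has only countably many discontinuities
(\<open>C_rd_countable_discontinuities\<close>), so dominated convergence applies
(\<open>delta_sums_converge\<close>). Fine divisions exist for every mesh (\<open>fine_division_exists\<close>), which makes the integral
unique.

For the inequality, let \<open>\<alpha>\<close> and \<open>\<beta>\<close> be slightly larger than the two weighted norms.
Convexity of the power function bounds \<open>((f + g) / (\<alpha> + \<beta>)) powr p\<close> pointwise by a convex combination of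
\<open>(f / \<alpha>) powr p\<close> and \<open>(g / \<beta>) powr p\<close>, whose integrals against the weight are at most \<open>1\<close>
(\<open>Minkowski_weighted_integral\<close>).
\<close>


section \<open>Right-dense continuous functions\<close>

text \<open>At a point that is not right-dense, \<open>T\<close> has no points immediately to the right, so the filter
\<open>at t within (ts_Icc T a b \<inter> {t<..})\<close> is trivial and every limit along it holds; dually on the left.
Hence the limit conditions hold at every point of \<open>ts_Icc T a b\<close>, and what follows needs no distinction
between dense and scattered points.\<close>
lemma C_rd_iff_one_sided_limits:
  "h \<in> C_rd T a b \<longleftrightarrow> (\<forall>t\<in>ts_Icc T a b.
     (h \<longlongrightarrow> h t) (at t within (ts_Icc T a b \<inter> {t<..})) \<and>
     (\<exists>L. (h \<longlongrightarrow> L) (at t within (ts_Icc T a b \<inter> {..<t}))))"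
proof -
  have right: "at t within (ts_Icc T a b \<inter> {t<..}) = bot" if "\<not> right_dense T t" for t
  proof (cases "\<exists>s\<in>T. t < s")
    case False
    then have "ts_Icc T a b \<inter> {t<..} = {}" by (auto simp: ts_Icc_def)
    then show ?thesis by simp
  next
    case True
    have "t \<le> Inf {s \<in> T. t < s}" using True by (intro cInf_greatest) auto
    with that True have less: "t < Inf {s \<in> T. t < s}"
      by (auto simp: right_dense_def ts_sigma_def)
    have "Inf {s \<in> T. t < s} \<le> s" if "s \<in> T" "t < s" for s
      using that by (intro cInf_lower bdd_belowI[of _ t]) auto
    then have "ts_Icc T a b \<inter> {t<..} \<inter> {..<Inf {s \<in> T. t < s}} = {}"
      by (force simp: ts_Icc_def)
    then have "\<not> t islimpt (ts_Icc T a b \<inter> {t<..})"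
      unfolding islimpt_def using less by (auto intro!: exI[of _ "{..<Inf {s \<in> T. t < s}}"])
    then show ?thesis by (simp add: trivial_limit_within)
  qed
  have left: "at t within (ts_Icc T a b \<inter> {..<t}) = bot" if "\<not> left_dense T t" for t
  proof (cases "\<exists>s\<in>T. s < t")
    case False
    then have "ts_Icc T a b \<inter> {..<t} = {}" by (auto simp: ts_Icc_def)
    then show ?thesis by simp
  next
    case True
    have "Sup {s \<in> T. s < t} \<le> t" using True by (intro cSup_least) auto
    with that True have less: "Sup {s \<in> T. s < t} < t"
      by (auto simp: left_dense_def ts_rho_def)
    have "s \<le> Sup {s \<in> T. s < t}" if "s \<in> T" "s < t" for s
      using that by (intro cSup_upper bdd_aboveI[of _ t]) auto
    then have "ts_Icc T a b \<inter> {..<t} \<inter> {Sup {s \<in> T. s < t}<..} = {}"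
      by (force simp: ts_Icc_def)
    then have "\<not> t islimpt (ts_Icc T a b \<inter> {..<t})"
      unfolding islimpt_def using less by (auto intro!: exI[of _ "{Sup {s \<in> T. s < t}<..}"])
    then show ?thesis by (simp add: trivial_limit_within)
  qed
  show ?thesis
    unfolding C_rd_def mem_Collect_eq
  proof (intro ball_cong refl conj_cong)
    fix t
    show "(right_dense T t \<longrightarrow> (h \<longlongrightarrow> h t) (at t within (ts_Icc T a b \<inter> {t<..})))
      \<longleftrightarrow> (h \<longlongrightarrow> h t) (at t within (ts_Icc T a b \<inter> {t<..}))"
      using right[of t] by (cases "right_dense T t") simp_all
    show "(left_dense T t \<longrightarrow> (\<exists>L. (h \<longlongrightarrow> L) (at t within (ts_Icc T a b \<inter> {..<t}))))
      \<longleftrightarrow> (\<exists>L. (h \<longlongrightarrow> L) (at t within (ts_Icc T a b \<inter> {..<t})))"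
      using left[of t] by (cases "left_dense T t") simp_all
  qed
qed

lemma C_rd_abs:
  assumes "h \<in> C_rd T a b"
  shows "(\<lambda>s. \<bar>h s\<bar>) \<in> C_rd T a b"
  using assms unfolding C_rd_iff_one_sided_limits by (blast intro: tendsto_rabs)

lemma C_rd_mult_continuous:
  assumes h: "h \<in> C_rd T a b" and k: "continuous_on (ts_Icc T a b) k"
  shows "(\<lambda>s. h s * k s) \<in> C_rd T a b"
  unfolding C_rd_iff_one_sided_limits
proof (intro ballI conjI)
  fix t assume t: "t \<in> ts_Icc T a b"
  have lim: "(k \<longlongrightarrow> k t) (at t within (ts_Icc T a b \<inter> B))" for B
    using k t by (auto simp: continuous_on_def intro: tendsto_within_subset)
  show "((\<lambda>s. h s * k s) \<longlongrightarrow> h t * k t) (at t within (ts_Icc T a b \<inter> {t<..}))"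
    using h t lim unfolding C_rd_iff_one_sided_limits by (blast intro: tendsto_mult)
  show "\<exists>L. ((\<lambda>s. h s * k s) \<longlongrightarrow> L) (at t within (ts_Icc T a b \<inter> {..<t}))"
    using h t lim unfolding C_rd_iff_one_sided_limits by (blast intro: tendsto_mult)
qed

lemma C_rd_right_limitE:
  assumes "h \<in> C_rd T a b" "t \<in> ts_Icc T a b" "0 < \<epsilon>"
  obtains d where "0 < d"
    and "\<And>s. s \<in> ts_Icc T a b \<Longrightarrow> t < s \<Longrightarrow> s < t + d \<Longrightarrow> \<bar>h s - h t\<bar> < \<epsilon>"
proof -
  have "(h \<longlongrightarrow> h t) (at t within (ts_Icc T a b \<inter> {t<..}))"
    using assms by (auto simp: C_rd_iff_one_sided_limits)
  then obtain d where d: "d > 0" "\<forall>s\<in>ts_Icc T a b \<inter> {t<..}. 0 < dist s t \<and> dist s t < d \<longrightarrow> dist (h s) (h t) < \<epsilon>"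
    using \<open>0 < \<epsilon>\<close> unfolding Lim_within by blast
  show ?thesis
    by (rule that[OF d(1)]) (use d(2) in \<open>auto simp: dist_real_def\<close>)
qed

lemma C_rd_left_limitE:
  assumes "h \<in> C_rd T a b" "t \<in> ts_Icc T a b" "0 < \<epsilon>"
  obtains d L where "0 < d"
    and "\<And>s. s \<in> ts_Icc T a b \<Longrightarrow> t - d < s \<Longrightarrow> s < t \<Longrightarrow> \<bar>h s - L\<bar> < \<epsilon>"
proof -
  obtain L where "(h \<longlongrightarrow> L) (at t within (ts_Icc T a b \<inter> {..<t}))"
    using assms by (auto simp: C_rd_iff_one_sided_limits)
  then obtain d where d: "d > 0" "\<forall>s\<in>ts_Icc T a b \<inter> {..<t}. 0 < dist s t \<and> dist s t < d \<longrightarrow> dist (h s) L < \<epsilon>"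
    using \<open>0 < \<epsilon>\<close> unfolding Lim_within by blast
  show ?thesis
    by (rule that[OF d(1), of L]) (use d(2) in \<open>auto simp: dist_real_def\<close>)
qed

lemma compact_ts_Icc:
  assumes "closed T"
  shows "compact (ts_Icc T a b)"
proof -
  have "ts_Icc T a b = {a..b} \<inter> T" by (auto simp: ts_Icc_def)
  then show ?thesis using assms by (simp add: compact_Int_closed)
qed

text \<open>One-sided limits bound \<open>h\<close> near each point; finitely many such neighbourhoods cover the compact
set \<open>ts_Icc T a b\<close>.\<close>
lemma C_rd_bounded:
  assumes "closed T" "h \<in> C_rd T a b"
  obtains M where "0 \<le> M" "\<And>s. s \<in> ts_Icc T a b \<Longrightarrow> \<bar>h s\<bar> \<le> M"
proof -
  let ?S = "ts_Icc T a b"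
  have "\<exists>U. open U \<and> t \<in> U \<and> bounded (h ` (?S \<inter> U))" if t: "t \<in> ?S" for t
  proof -
    obtain d where d: "0 < d" "\<And>s. s \<in> ?S \<Longrightarrow> t < s \<Longrightarrow> s < t + d \<Longrightarrow> \<bar>h s - h t\<bar> < 1"
      using C_rd_right_limitE[OF assms(2) t, of 1] by auto
    obtain d' L where d': "0 < d'" "\<And>s. s \<in> ?S \<Longrightarrow> t - d' < s \<Longrightarrow> s < t \<Longrightarrow> \<bar>h s - L\<bar> < 1"
      using C_rd_left_limitE[OF assms(2) t, of 1] by auto
    have "\<bar>h s\<bar> \<le> \<bar>h t\<bar> + \<bar>L\<bar> + 1" if "s \<in> ?S \<inter> {t - d'<..<t + d}" for s
      using that d(2)[of s] d'(2)[of s] by (cases s t rule: linorder_cases) auto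
    then have "bounded (h ` (?S \<inter> {t - d'<..<t + d}))"
      unfolding bounded_iff by (auto intro!: exI[of _ "\<bar>h t\<bar> + \<bar>L\<bar> + 1"])
    then show ?thesis
      using d(1) d'(1) by (intro exI[of _ "{t - d'<..<t + d}"]) auto
  qed
  then obtain U where U: "\<And>t. t \<in> ?S \<Longrightarrow> open (U t) \<and> t \<in> U t \<and> bounded (h ` (?S \<inter> U t))"
    by metis
  obtain C where C: "C \<subseteq> ?S" "finite C" "?S \<subseteq> (\<Union>t\<in>C. U t)"
    by (rule compactE_image[OF compact_ts_Icc[OF assms(1)], of ?S U]) (use U in auto)
  have "bounded (\<Union>t\<in>C. h ` (?S \<inter> U t))"
    using C U by (intro bounded_UN) auto
  then have "bounded (h ` ?S)"
    by (rule bounded_subset) (use C in blast)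
  then obtain M where "0 < M" "\<forall>x\<in>h ` ?S. norm x \<le> M"
    using bounded_pos by blast
  then show ?thesis using that[of M] by auto
qed

text \<open>The intervals \<open>(t - d, t)\<close> attached to distinct points of \<open>J\<close> are disjoint, and each contains a
rational number.\<close>
lemma countable_left_isolated:
  fixes J :: "real set"
  assumes "\<And>t. t \<in> J \<Longrightarrow> \<exists>d>0. J \<inter> {t - d<..<t} = {}"
  shows "countable J"
proof -
  from assms have "\<forall>t\<in>J. \<exists>d>0. J \<inter> {t - d<..<t} = {}" by blast
  from bchoice[OF this] obtain d where d: "\<And>t. t \<in> J \<Longrightarrow> 0 < d t \<and> J \<inter> {t - d t<..<t} = {}"
    by blast
  have "\<forall>t\<in>J. \<exists>q. q \<in> \<rat> \<and> t - d t < q \<and> q < t"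
  proof
    fix t assume "t \<in> J"
    then have "t - d t < t" using d by simp
    from Rats_dense_in_real[OF this] show "\<exists>q. q \<in> \<rat> \<and> t - d t < q \<and> q < t" by blast
  qed
  from bchoice[OF this] obtain q where q: "\<And>t. t \<in> J \<Longrightarrow> q t \<in> \<rat> \<and> t - d t < q t \<and> q t < t"
    by blast
  have "q s < q t" if "s \<in> J" "t \<in> J" "s < t" for s t
  proof -
    have "s \<le> t - d t" using d[OF \<open>t \<in> J\<close>] that by force
    then show ?thesis using q[OF \<open>s \<in> J\<close>] q[OF \<open>t \<in> J\<close>] by linarith
  qed
  then have "inj_on q J"
    by (intro linorder_inj_onI') fastforce
  moreover have "countable (q ` J)"
    using q by (intro countable_subset[OF _ countable_rat]) auto
  ultimately show ?thesis by (rule countable_image_inj_on[rotated])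
qed

text \<open>A discontinuity can only be a jump from the left. Fix a jump size: since the left limit at \<open>t\<close>
exists, \<open>h\<close> oscillates arbitrarily little just to the left of \<open>t\<close>, so no other jump of that
size lies there. The jumps of a given size are thus isolated from the left, hence countable.\<close>
lemma C_rd_countable_discontinuities:
  assumes h: "h \<in> C_rd T a b"
  shows "countable {t \<in> ts_Icc T a b. \<not> continuous (at t within ts_Icc T a b) h}"
proof -
  let ?S = "ts_Icc T a b"
  \<comment> \<open>\<open>J k\<close>: the points at which \<open>h\<close> jumps by at least \<open>1/(k+1)\<close> when approached from the left\<close>
  define J where "J = (\<lambda>k::nat. {t \<in> ?S. \<forall>d>0. \<exists>u\<in>?S. t - d < u \<and> u < t \<and> 1 / Suc k \<le> \<bar>h u - h t\<bar>})"
  have "countable (J k)" for k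
  proof (rule countable_left_isolated)
    fix t assume t: "t \<in> J k"
    then have tS: "t \<in> ?S" by (simp add: J_def)
    \<comment> \<open>half the jump size: two values of \<open>h\<close> within \<open>c\<close> of \<open>L\<close> cannot differ by \<open>1/(k+1)\<close>\<close>
    define c where "c = 1 / real (Suc k) / 2"
    then have "0 < c" by simp
    obtain d L where d: "0 < d"
        "\<And>s. s \<in> ?S \<Longrightarrow> t - d < s \<Longrightarrow> s < t \<Longrightarrow> \<bar>h s - L\<bar> < c"
      using C_rd_left_limitE[OF h tS \<open>0 < c\<close>] by blast
    have False if s: "s \<in> J k" "t - d < s" "s < t" for s
    proof -
      have "0 < s - (t - d)" using s by simp
      then obtain u where u: "u \<in> ?S" "s - (s - (t - d)) < u" "u < s" "1 / Suc k \<le> \<bar>h u - h s\<bar>"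
        using s(1) unfolding J_def by blast
      have "s \<in> ?S" using s(1) by (simp add: J_def)
      then have "\<bar>h u - L\<bar> < c" "\<bar>h s - L\<bar> < c"
        using d(2)[of u] d(2)[of s] u(1-3) s by simp_all
      moreover have "c + c = 1 / real (Suc k)" unfolding c_def by (rule field_sum_of_halves)
      ultimately show False using u(4) by linarith
    qed
    then show "\<exists>d>0. J k \<inter> {t - d<..<t} = {}"
      using d(1) by (intro exI[of _ d]) auto
  qed
  moreover have "{t \<in> ?S. \<not> continuous (at t within ?S) h} \<subseteq> (\<Union>k. J k)"
  proof
    fix t assume "t \<in> {t \<in> ?S. \<not> continuous (at t within ?S) h}"
    then have tS: "t \<in> ?S" and "\<not> continuous (at t within ?S) h" by auto
    then obtain e where e: "e > 0" "\<And>d. d > 0 \<Longrightarrow> \<exists>s\<in>?S. dist s t < d \<and> \<not> dist (h s) (h t) < e"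
      unfolding continuous_within_eps_delta by blast
    obtain d' where d': "0 < d'" "\<And>s. s \<in> ?S \<Longrightarrow> t < s \<Longrightarrow> s < t + d' \<Longrightarrow> \<bar>h s - h t\<bar> < e"
      using C_rd_right_limitE[OF h tS e(1)] by auto
    obtain k where k: "1 / Suc k < e"
      using e(1) nat_approx_posE by blast
    have "\<exists>u\<in>?S. t - d < u \<and> u < t \<and> 1 / Suc k \<le> \<bar>h u - h t\<bar>" if "d > 0" for d
    proof -
      obtain u where u: "u \<in> ?S" "dist u t < min d d'" "\<not> dist (h u) (h t) < e"
        using e(2)[of "min d d'"] \<open>d > 0\<close> d'(1) by auto
      then have "u < t"
        using d'(2)[of u] e(1) by (cases u t rule: linorder_cases) (auto simp: dist_real_def)
      then show ?thesis using u k
        by (intro bexI[of _ u] conjI) (auto simp: dist_real_def)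
    qed
    then show "t \<in> (\<Union>k. J k)" using tS unfolding J_def by blast
  qed
  ultimately show ?thesis
    by (meson countable_UN countableI_type countable_subset)
qed


section \<open>Constant extension across gaps\<close>

text \<open>Constant extension across the gaps: a function \<open>h\<close> on \<open>T\<close> becomes the function
\<open>h \<circ> last_point T\<close> on the real interval, which on a gap to the right of \<open>t\<close> has the value \<open>h t\<close>. This is
the value that the tag of a sufficiently fine division is forced to pick up there.\<close>
definition last_point :: "real set \<Rightarrow> real \<Rightarrow> real" where
  "last_point T x = Sup {s \<in> T. s \<le> x}"

lemma last_point_upper:
  assumes "s \<in> T" "s \<le> x"
  shows "s \<le> last_point T x"
  unfolding last_point_def using assms by (intro cSup_upper bdd_aboveI[of _ x]) auto

lemma last_point_self:
  assumes "x \<in> T"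
  shows "last_point T x = x"
  unfolding last_point_def using assms by (intro cSup_eq_maximum) auto

lemma last_point_in_ts_Icc:
  assumes "closed T" "a \<in> T" "x \<in> {a..b}"
  shows "last_point T x \<in> ts_Icc T a x" "last_point T x \<in> ts_Icc T a b"
proof -
  have eq: "{s \<in> T. s \<le> x} = T \<inter> {..x}" by auto
  have "last_point T x \<in> T \<inter> {..x}"
    unfolding last_point_def eq using assms
    by (intro closed_contains_Sup closed_Int bdd_aboveI[of _ x]) auto
  then show "last_point T x \<in> ts_Icc T a x" "last_point T x \<in> ts_Icc T a b"
    using last_point_upper[of a T x] assms by (auto simp: ts_Icc_def)
qed

lemma no_point_between_ts_rho:
  assumes "ts_rho T v = u" "s \<in> T" "s < v"
  shows "s \<le> u"
proof -
  have "s \<le> Sup {s \<in> T. s < v}"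
    using assms by (intro cSup_upper bdd_aboveI[of _ v]) auto
  then show ?thesis using assms by (auto simp: ts_rho_def)
qed


section \<open>Fine divisions\<close>

definition tagged_fine_division ::
    "real \<Rightarrow> real set \<Rightarrow> real \<Rightarrow> real \<Rightarrow> nat \<Rightarrow> (nat \<Rightarrow> real) \<Rightarrow> (nat \<Rightarrow> real) \<Rightarrow> bool" where
  "tagged_fine_division \<delta> T a b n t \<xi> \<longleftrightarrow>
     fine_division \<delta> T a b n t \<and> (\<forall>i<n. \<xi> i \<in> ts_Ico T (t i) (t (Suc i)))"

lemma tagged_fine_division_tag_in_ts_Icc:
  assumes tag: "tagged_fine_division \<delta> T a b n t \<xi>" and i: "i < n"
  shows "\<xi> i \<in> ts_Icc T a b"
proof -
  have "t i \<in> ts_Icc T a b" "t (Suc i) \<in> ts_Icc T a b" "\<xi> i \<in> ts_Ico T (t i) (t (Suc i))"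
    using tag i by (auto simp: tagged_fine_division_def fine_division_def ts_division_def)
  then show ?thesis by (auto simp: ts_Icc_def ts_Ico_def)
qed

lemma fine_division_mono:
  assumes "fine_division \<delta> T a b n t" "\<delta> \<le> \<delta>'"
  shows "fine_division \<delta>' T a b n t"
  using assms unfolding fine_division_def by (meson linorder_not_less order_trans)

lemma fine_division_append:
  assumes t: "fine_division \<delta> T a y n t" and "y < x" "x \<in> T"
    and step: "x - y \<le> \<delta> \<or> ts_rho T x = y"
  shows "fine_division \<delta> T a x (Suc n) (t(Suc n := x))"
proof -
  have "t 0 = a" "t n = y" "\<And>i. i < n \<Longrightarrow> t i < t (Suc i)" "\<And>i. i \<le> n \<Longrightarrow> t i \<in> ts_Icc T a y"
    using t by (auto simp: fine_division_def ts_division_def)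
  moreover from this have "a \<le> y" by (force simp: ts_Icc_def)
  ultimately show ?thesis
    using t assms(2,3) step unfolding fine_division_def ts_division_def
    by (force simp: less_Suc_eq le_Suc_eq ts_Icc_def)
qed

text \<open>The set \<open>R\<close> of end points that can be reached by a fine division contains its supremum \<open>m\<close>,
because one more step of length at most \<open>\<delta>\<close> leads from a nearby element to \<open>m\<close>. If \<open>m\<close> were smaller than
\<open>b\<close>, a further step would pass beyond it: a short step if \<open>T\<close> has points in \<open>(m, m + \<delta>]\<close>,
and otherwise the jump across the gap.\<close>
lemma fine_division_exists:
  assumes T: "closed T" and "a \<in> T" "b \<in> T" "a \<le> b" and "0 < \<delta>"
  shows "\<exists>n t. fine_division \<delta> T a b n t"
proof -
  define R where "R = {x \<in> ts_Icc T a b. \<exists>n t. fine_division \<delta> T a x n t}"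
  have extend: "x \<in> R" if "y \<in> R" "y < x" "x \<in> ts_Icc T a b" "x - y \<le> \<delta> \<or> ts_rho T x = y" for x y
    using that fine_division_append[of \<delta> T a y _ _ x] unfolding R_def ts_Icc_def by blast
  have "fine_division \<delta> T a a 0 (\<lambda>_. a)"
    using \<open>a \<in> T\<close> by (simp add: fine_division_def ts_division_def ts_Icc_def)
  then have "a \<in> R"
    using assms by (auto simp: R_def ts_Icc_def)
  have bdd: "bdd_above R" by (intro bdd_aboveI[of _ b]) (auto simp: R_def ts_Icc_def)
  define m where "m = Sup R"
  have upper: "x \<le> m" if "x \<in> R" for x
    unfolding m_def using that bdd by (rule cSup_upper)
  have m: "m \<in> ts_Icc T a b"
  proof -
    have "m \<in> closure R" unfolding m_def using \<open>a \<in> R\<close> bdd by (intro closure_contains_Sup) auto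
    moreover have "closure R \<subseteq> ts_Icc T a b"
      using compact_ts_Icc[OF T] by (intro closure_minimal compact_imp_closed) (auto simp: R_def)
    ultimately show ?thesis by blast
  qed
  have "m \<in> R"
  proof (rule ccontr)
    assume "m \<notin> R"
    obtain y where y: "y \<in> R" "m - \<delta> < y"
      using less_cSupD[of R "m - \<delta>"] \<open>a \<in> R\<close> \<open>0 < \<delta>\<close> unfolding m_def by auto
    moreover have "y < m" using upper[OF y(1)] y(1) \<open>m \<notin> R\<close> by (cases "y = m") auto
    ultimately show False using extend[OF y(1) _ m] \<open>m \<notin> R\<close> by auto
  qed
  have "m = b"
  proof (rule ccontr)
    assume "m \<noteq> b"
    then have "m < b" using m by (simp add: ts_Icc_def)
    show False
    proof (cases "\<exists>x\<in>T. m < x \<and> x \<le> b \<and> x \<le> m + \<delta>")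
      case True
      then obtain x where "x \<in> T" "m < x" "x \<le> b" "x \<le> m + \<delta>" by blast
      then have "x \<in> R" using extend[OF \<open>m \<in> R\<close>, of x] m by (auto simp: ts_Icc_def)
      then show False using upper[of x] \<open>m < x\<close> by simp
    next
      \<comment> \<open>here \<open>m\<close> is followed by a gap longer than \<open>\<delta>\<close>, and \<open>v\<close> is its right end\<close>
      case False
      let ?A = "T \<inter> {m + \<delta>..b}"
      define v where "v = Inf ?A"
      have "b \<in> ?A" using False \<open>m < b\<close> \<open>b \<in> T\<close> by force
      then have "v \<in> ?A" unfolding v_def
        using T by (intro closed_contains_Inf closed_Int bdd_belowI[of _ "m + \<delta>"]) auto
      have least: "v \<le> s" if "s \<in> ?A" for s
        unfolding v_def using that by (intro cInf_lower bdd_belowI[of _ "m + \<delta>"]) auto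
      have "s \<le> m" if "s \<in> T" "s < v" for s
        using least[of s] False that \<open>v \<in> ?A\<close> by force
      then have "ts_rho T v = m"
        unfolding ts_rho_def using m \<open>v \<in> ?A\<close> \<open>0 < \<delta>\<close>
        by (auto intro!: cSup_eq_maximum simp: ts_Icc_def intro: bexI[of _ m])
      then have "v \<in> R" using extend[OF \<open>m \<in> R\<close>, of v] m \<open>v \<in> ?A\<close> \<open>0 < \<delta>\<close> by (auto simp: ts_Icc_def)
      then show False using upper[of v] \<open>v \<in> ?A\<close> \<open>0 < \<delta>\<close> by auto
    qed
  qed
  then show ?thesis using \<open>m \<in> R\<close> by (simp add: R_def)
qed

lemma tagged_fine_division_exists:
  assumes "closed T" "a \<in> T" "b \<in> T" "a \<le> b" "0 < \<delta>"
  shows "\<exists>n t \<xi>. tagged_fine_division \<delta> T a b n t \<xi>"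
proof -
  obtain n t where t: "fine_division \<delta> T a b n t"
    using fine_division_exists[OF assms] by blast
  then have "tagged_fine_division \<delta> T a b n t t"
    by (auto simp: tagged_fine_division_def fine_division_def ts_division_def ts_Icc_def ts_Ico_def)
  then show ?thesis by blast
qed

lemma ts_division_mono:
  assumes "ts_division T a b n t" "i \<le> j" "j \<le> n"
  shows "t i \<le> t j"
  using assms(2,3)
proof (induction j rule: dec_induct)
  case (step m)
  then have "t i \<le> t m" "t m < t (Suc m)" using assms(1) by (auto simp: ts_division_def)
  then show ?case by simp
qed simp

lemma ts_division_locate:
  assumes "ts_division T a b n t" "a \<le> x" "x < b"
  obtains i where "i < n" "t i \<le> x" "x < t (Suc i)"
proof -
  have ends: "t 0 \<le> x" "x < t n" using assms by (auto simp: ts_division_def)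
  define j where "j = (LEAST j. x < t j)"
  have j: "x < t j" "j \<le> n"
    unfolding j_def using ends by (auto intro: LeastI Least_le)
  then obtain i where i: "j = Suc i" using ends by (cases j) auto
  then have "\<not> x < t i" unfolding j_def by (metis lessI not_less_Least)
  then show ?thesis using that[of i] i j by simp
qed


section \<open>Riemann delta-sums as integrals of step functions\<close>

text \<open>The pieces are half-open, as the tag ranges are, so that the value at \<open>x\<close> comes from the unique
piece with \<open>t i \<le> x < t (Suc i)\<close>.\<close>
definition step_function ::
    "nat \<Rightarrow> (nat \<Rightarrow> real) \<Rightarrow> (nat \<Rightarrow> real) \<Rightarrow> (real \<Rightarrow> real) \<Rightarrow> real \<Rightarrow> real" where
  "step_function n t \<xi> h x = (\<Sum>i<n. if t i \<le> x \<and> x < t (Suc i) then h (\<xi> i) else 0)"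

lemma step_function_eq:
  assumes t: "ts_division T a b n t" and i: "i < n" "t i \<le> x" "x < t (Suc i)"
  shows "step_function n t \<xi> h x = h (\<xi> i)"
proof -
  have "(t j \<le> x \<and> x < t (Suc j)) \<longleftrightarrow> j = i" if "j < n" for j
    using ts_division_mono[OF t, of "Suc j" i] ts_division_mono[OF t, of "Suc i" j] that i
    by (cases j i rule: linorder_cases) auto
  then have "step_function n t \<xi> h x = (\<Sum>j<n. if j = i then h (\<xi> j) else 0)"
    unfolding step_function_def by (intro sum.cong) auto
  then show ?thesis using i by simp
qed

lemma step_function_bounded:
  assumes t: "ts_division T a b n t" and \<xi>: "\<And>i. i < n \<Longrightarrow> \<bar>h (\<xi> i)\<bar> \<le> M" and "0 \<le> M"
  shows "\<bar>step_function n t \<xi> h x\<bar> \<le> M"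
proof (cases "\<exists>i<n. t i \<le> x \<and> x < t (Suc i)")
  case True
  then show ?thesis using step_function_eq[OF t] \<xi> by metis
next
  case False
  then have "step_function n t \<xi> h x = 0" unfolding step_function_def by (intro sum.neutral) auto
  then show ?thesis using \<open>0 \<le> M\<close> by simp
qed

lemma step_function_has_integral:
  assumes t: "ts_division T a b n t"
  shows "(step_function n t \<xi> h has_integral (\<Sum>i<n. (t (Suc i) - t i) * h (\<xi> i))) {a..b}"
  unfolding step_function_def
proof (intro has_integral_sum)
  fix i assume "i \<in> {..<n}"
  then have i: "i < n" by simp
  then have le: "t i \<le> t (Suc i)" "a \<le> t i" "t (Suc i) \<le> b"
    using t by (auto simp: ts_division_def ts_Icc_def less_imp_le)
  have "((\<lambda>x. h (\<xi> i)) has_integral (t (Suc i) - t i) * h (\<xi> i)) (cbox (t i) (t (Suc i)))"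
    using has_integral_const_real[of "h (\<xi> i)" "t i" "t (Suc i)"] le by simp
  then have "((\<lambda>x. if x \<in> cbox (t i) (t (Suc i)) then h (\<xi> i) else 0)
      has_integral (t (Suc i) - t i) * h (\<xi> i)) (cbox a b)"
    by (rule has_integral_restrict_closed_subinterval) (use le in auto)
  then show "((\<lambda>x. if t i \<le> x \<and> x < t (Suc i) then h (\<xi> i) else 0)
      has_integral (t (Suc i) - t i) * h (\<xi> i)) {a..b}"
    unfolding box_real by (rule has_integral_spike_finite[rotated 2, of _ _ _ "{t (Suc i)}"]) auto
qed simp

text \<open>Consider the piece containing \<open>x\<close>. If it is short, its tag is a point of \<open>T\<close> close to \<open>x\<close>: when \<open>x\<close> is in \<open>T\<close>
continuity at \<open>x\<close> applies, and otherwise there is no such point, \<open>T\<close> being closed.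
If the piece is long, it is a gap of \<open>T\<close>, and both the tag and \<open>last_point T x\<close> are
its left end.\<close>
lemma step_function_near_last_point:
  assumes T: "closed T" "a \<in> T" and x: "a \<le> x" "x < b"
    and cont: "x \<in> T \<Longrightarrow> continuous (at x within ts_Icc T a b) h" and "0 < \<epsilon>"
  shows "\<exists>d>0. \<forall>\<delta> n t \<xi>. \<delta> < d \<longrightarrow> tagged_fine_division \<delta> T a b n t \<xi> \<longrightarrow>
    \<bar>step_function n t \<xi> h x - h (last_point T x)\<bar> < \<epsilon>"
proof -
  obtain d where "0 < d" and d: "\<And>s. s \<in> ts_Icc T a b \<Longrightarrow> \<bar>s - x\<bar> < d \<Longrightarrow> \<bar>h s - h (last_point T x)\<bar> < \<epsilon>"
  proof (cases "x \<in> T")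
    case True
    then obtain d where "d > 0" "\<forall>s\<in>ts_Icc T a b. dist s x < d \<longrightarrow> dist (h s) (h x) < \<epsilon>"
      using cont \<open>0 < \<epsilon>\<close> unfolding continuous_within_eps_delta by blast
    then show ?thesis
      using that[of d] True by (auto simp: dist_real_def last_point_self)
  next
    case False
    then obtain d where "d > 0" "\<forall>y. dist y x < d \<longrightarrow> y \<notin> T"
      using T(1) by (metis closed_approachable)
    then show ?thesis
      using that[of d] by (auto simp: dist_real_def ts_Icc_def)
  qed
  have "\<bar>step_function n t \<xi> h x - h (last_point T x)\<bar> < \<epsilon>"
    if "\<delta> < d" and tag: "tagged_fine_division \<delta> T a b n t \<xi>" for \<delta> n t \<xi>
  proof -
    have t: "ts_division T a b n t"
      using tag by (simp add: tagged_fine_division_def fine_division_def)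
    obtain i where i: "i < n" "t i \<le> x" "x < t (Suc i)"
      using ts_division_locate[OF t x] .
    have \<xi>: "\<xi> i \<in> T" "t i \<le> \<xi> i" "\<xi> i < t (Suc i)"
      using tag i(1) by (auto simp: tagged_fine_division_def ts_Ico_def)
    have ti: "t i \<in> T" "a \<le> t i" "t (Suc i) \<le> b"
      using t i(1) by (auto simp: ts_division_def ts_Icc_def)
    from tag i(1) consider "t (Suc i) - t i \<le> \<delta>" | "ts_rho T (t (Suc i)) = t i"
      by (auto simp: tagged_fine_division_def fine_division_def)
    then have "\<bar>h (\<xi> i) - h (last_point T x)\<bar> < \<epsilon>"
    proof cases
      case 1
      then show ?thesis using \<xi> ti i \<open>\<delta> < d\<close> by (intro d) (auto simp: ts_Icc_def)
    next
      case 2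
      have "last_point T x \<in> ts_Icc T a x"
        using last_point_in_ts_Icc(1)[OF T, of x x] x by simp
      then have "last_point T x = t i"
        using no_point_between_ts_rho[OF 2, of "last_point T x"] last_point_upper[OF ti(1) i(2)] i(3)
        by (simp add: ts_Icc_def)
      moreover have "\<xi> i = t i" using no_point_between_ts_rho[OF 2] \<xi> by force
      ultimately show ?thesis using \<open>0 < \<epsilon>\<close> by simp
    qed
    then show ?thesis by (simp add: step_function_eq[OF t i])
  qed
  then show ?thesis using \<open>0 < d\<close> by blast
qed

text \<open>Dominated convergence for the step functions of the divisions; integrability of the limit is
part of the conclusion. The excluded null set consists of the countably many discontinuities and of \<open>b\<close>,
which belongs to no piece.\<close>
lemma delta_sums_converge:
  assumes T: "closed T" "a \<in> T" and h: "h \<in> C_rd T a b"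
    and tag: "\<And>k. tagged_fine_division (\<delta> k) T a b (n k) (t k) (\<xi> k)" and \<delta>: "\<delta> \<longlonglongrightarrow> 0"
  shows "(\<lambda>x. h (last_point T x)) integrable_on {a..b}"
    and "(\<lambda>k. \<Sum>i<n k. (t k (Suc i) - t k i) * h (\<xi> k i))
      \<longlonglongrightarrow> integral {a..b} (\<lambda>x. h (last_point T x))"
proof -
  define N where "N = insert b {t \<in> ts_Icc T a b. \<not> continuous (at t within ts_Icc T a b) h}"
  have "negligible N"
    unfolding N_def using C_rd_countable_discontinuities[OF h]
    by (simp add: negligible_iff_null_sets countable_imp_null_set_lborel null_sets_completionI)
  obtain M where M: "0 \<le> M" "\<And>s. s \<in> ts_Icc T a b \<Longrightarrow> \<bar>h s\<bar> \<le> M"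
    using C_rd_bounded[OF T(1) h] by blast
  have t: "ts_division T a b (n k) (t k)" for k
    using tag[of k] by (simp add: tagged_fine_division_def fine_division_def)
  let ?G = "\<lambda>k x. step_function (n k) (t k) (\<xi> k) h x"
  let ?H = "\<lambda>x. h (last_point T x)"
  \<comment> \<open>everything is set to \<open>0\<close> on \<open>N\<close> so that the convergence holds at every point\<close>
  have int: "((\<lambda>x. if x \<in> N then 0 else ?G k x) has_integral
      (\<Sum>i<n k. (t k (Suc i) - t k i) * h (\<xi> k i))) {a..b}" for k
    by (rule has_integral_spike[OF \<open>negligible N\<close> _ step_function_has_integral[OF t]]) auto
  have bound: "norm (if x \<in> N then 0 else ?G k x) \<le> M" for k x
  proof -
    have "\<bar>h (\<xi> k i)\<bar> \<le> M" if "i < n k" for i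
      using tagged_fine_division_tag_in_ts_Icc[OF tag that] by (rule M(2))
    then show ?thesis using step_function_bounded[OF t _ M(1)] M(1) by auto
  qed
  have lim: "(\<lambda>k. if x \<in> N then 0 else ?G k x) \<longlonglongrightarrow> (if x \<in> N then 0 else ?H x)"
    if x: "x \<in> {a..b}" for x
  proof (cases "x \<in> N")
    case False
    then have xb: "x < b" and cont: "x \<in> T \<Longrightarrow> continuous (at x within ts_Icc T a b) h"
      using x by (auto simp: N_def ts_Icc_def)
    have "(\<lambda>k. ?G k x) \<longlonglongrightarrow> ?H x"
    proof (rule LIMSEQ_I)
      fix e :: real assume "0 < e"
      then obtain d where "d > 0" and d: "\<And>\<delta> n t \<xi>. \<delta> < d \<Longrightarrow> tagged_fine_division \<delta> T a b n t \<xi> \<Longrightarrow>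
          \<bar>step_function n t \<xi> h x - ?H x\<bar> < e"
        using step_function_near_last_point[OF T _ xb cont] x by force
      have "eventually (\<lambda>k. \<delta> k < d) sequentially"
        using order_tendstoD(2)[OF \<delta> \<open>d > 0\<close>] .
      then obtain k0 where "\<And>k. k \<ge> k0 \<Longrightarrow> \<delta> k < d"
        unfolding eventually_sequentially by blast
      then show "\<exists>k0. \<forall>k\<ge>k0. norm (?G k x - ?H x) < e"
        using d[OF _ tag] by (auto intro!: exI[of _ k0])
    qed
    then show ?thesis using False by simp
  qed simp
  have "(\<lambda>x. M) integrable_on {a..b}" by (rule integrable_const_ivl)
  note dct = dominated_convergence[OF has_integral_integrable[OF int] this bound lim]
  show "?H integrable_on {a..b}"
    by (rule integrable_spike[OF dct(1) \<open>negligible N\<close>]) auto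
  have "integral {a..b} (\<lambda>x. if x \<in> N then 0 else ?H x) = integral {a..b} ?H"
    by (rule integral_spike[OF \<open>negligible N\<close>]) auto
  then show "(\<lambda>k. \<Sum>i<n k. (t k (Suc i) - t k i) * h (\<xi> k i)) \<longlonglongrightarrow> integral {a..b} ?H"
    using dct(2) by (simp add: integral_unique[OF int])
qed

lemma C_rd_last_point_integrable:
  assumes "closed T" "a \<in> T" "b \<in> T" "a \<le> b" "h \<in> C_rd T a b"
  shows "(\<lambda>x. h (last_point T x)) integrable_on {a..b}"
proof -
  have "\<forall>k. \<exists>n t \<xi>. tagged_fine_division (inverse (real (Suc k))) T a b n t \<xi>"
    using assms by (intro allI tagged_fine_division_exists) auto
  from this[unfolded choice_iff] obtain n t \<xi>
    where "\<And>k. tagged_fine_division (inverse (real (Suc k))) T a b (n k) (t k) (\<xi> k)"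
    by blast
  from delta_sums_converge(1)[OF assms(1,2,5) this LIMSEQ_inverse_real_of_nat] show ?thesis .
qed

text \<open>A failure for some \<open>\<epsilon>\<close> would supply, for mesh \<open>1/(k+1)\<close>, divisions whose sums stay \<open>\<epsilon>\<close> away from
the integral.\<close>
lemma C_rd_delta_integral:
  assumes "closed T" "a \<in> T" "h \<in> C_rd T a b" "0 < \<epsilon>"
  shows "\<exists>\<delta>>0. \<forall>n t \<xi>. tagged_fine_division \<delta> T a b n t \<xi> \<longrightarrow>
    \<bar>(\<Sum>i<n. (t (Suc i) - t i) * h (\<xi> i)) - integral {a..b} (\<lambda>x. h (last_point T x))\<bar> < \<epsilon>"
proof (rule ccontr)
  let ?I = "integral {a..b} (\<lambda>x. h (last_point T x))"
  assume "\<not> ?thesis"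
  then have "\<exists>n t \<xi>. tagged_fine_division \<delta> T a b n t \<xi> \<and>
      \<not> \<bar>(\<Sum>i<n. (t (Suc i) - t i) * h (\<xi> i)) - ?I\<bar> < \<epsilon>" if "0 < \<delta>" for \<delta>
    using that by blast
  then have "\<forall>k. \<exists>n t \<xi>. tagged_fine_division (inverse (real (Suc k))) T a b n t \<xi> \<and>
      \<not> \<bar>(\<Sum>i<n. (t (Suc i) - t i) * h (\<xi> i)) - ?I\<bar> < \<epsilon>"
    by simp
  from this[unfolded choice_iff] obtain n t \<xi> where
      *: "\<And>k. tagged_fine_division (inverse (real (Suc k))) T a b (n k) (t k) (\<xi> k)"
      "\<And>k. \<not> \<bar>(\<Sum>i<n k. (t k (Suc i) - t k i) * h (\<xi> k i)) - ?I\<bar> < \<epsilon>"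
    by blast
  have "(\<lambda>k. \<Sum>i<n k. (t k (Suc i) - t k i) * h (\<xi> k i)) \<longlonglongrightarrow> ?I"
    using delta_sums_converge(2)[OF assms(1-3) *(1) LIMSEQ_inverse_real_of_nat] .
  from LIMSEQ_D[OF this \<open>0 < \<epsilon>\<close>] show False
    using *(2) by auto
qed


section \<open>The interval integral by endpoints\<close>

definition delta_integral :: "real set \<Rightarrow> real \<Rightarrow> real \<Rightarrow> (real \<Rightarrow> real) \<Rightarrow> real" where
  "delta_integral T a b h = integral {a..b} (\<lambda>x. h (last_point T x))"

lemma bounds_sum:
  fixes f :: "'i \<Rightarrow> real interval"
  shows "lower (\<Sum>i\<in>A. f i) = (\<Sum>i\<in>A. lower (f i))" "upper (\<Sum>i\<in>A. f i) = (\<Sum>i\<in>A. upper (f i))"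
  by (induction A rule: infinite_finite_induct) auto

lemma bounds_riemann_delta_sum:
  assumes "ts_division T a b n t"
  shows "lower (riemann_delta_sum F n t \<xi>) = (\<Sum>i<n. (t (Suc i) - t i) * lower (F (\<xi> i)))"
    and "upper (riemann_delta_sum F n t \<xi>) = (\<Sum>i<n. (t (Suc i) - t i) * upper (F (\<xi> i)))"
proof -
  have "0 \<le> t (Suc i) - t i" if "i < n" for i
    using assms that by (auto simp: ts_division_def less_imp_le)
  then show "lower (riemann_delta_sum F n t \<xi>) = (\<Sum>i<n. (t (Suc i) - t i) * lower (F (\<xi> i)))"
    and "upper (riemann_delta_sum F n t \<xi>) = (\<Sum>i<n. (t (Suc i) - t i) * upper (F (\<xi> i)))"
    unfolding riemann_delta_sum_def bounds_sum by (auto intro!: sum.cong simp: bounds_interval_scale)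
qed

text \<open>Two integrals are both close to one Riemann sum. That a sufficiently fine division exists is
essential here: otherwise every interval would be an integral.\<close>
lemma has_IR_integral_unique:
  assumes T: "closed T" "a \<in> T" "b \<in> T" "a \<le> b"
    and A: "has_IR_integral T a b F A" and B: "has_IR_integral T a b F B"
  shows "A = B"
proof -
  have close: "interval_dist A B < \<epsilon> + \<epsilon>" if "0 < \<epsilon>" for \<epsilon>
  proof -
    obtain \<delta> where \<delta>: "0 < \<delta>" "\<And>n t \<xi>. tagged_fine_division \<delta> T a b n t \<xi> \<Longrightarrow>
        interval_dist (riemann_delta_sum F n t \<xi>) A < \<epsilon>"
      using A \<open>0 < \<epsilon>\<close> unfolding has_IR_integral_def tagged_fine_division_def by meson
    obtain \<delta>' where \<delta>': "0 < \<delta>'" "\<And>n t \<xi>. tagged_fine_division \<delta>' T a b n t \<xi> \<Longrightarrow>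
        interval_dist (riemann_delta_sum F n t \<xi>) B < \<epsilon>"
      using B \<open>0 < \<epsilon>\<close> unfolding has_IR_integral_def tagged_fine_division_def by meson
    obtain n t \<xi> where tag: "tagged_fine_division (min \<delta> \<delta>') T a b n t \<xi>"
      using tagged_fine_division_exists[OF T, of "min \<delta> \<delta>'"] \<delta>(1) \<delta>'(1) by auto
    then have "tagged_fine_division \<delta> T a b n t \<xi>" "tagged_fine_division \<delta>' T a b n t \<xi>"
      by (auto simp: tagged_fine_division_def intro: fine_division_mono)
    then have "interval_dist (riemann_delta_sum F n t \<xi>) A < \<epsilon>"
        "interval_dist (riemann_delta_sum F n t \<xi>) B < \<epsilon>"
      using \<delta>(2) \<delta>'(2) by auto
    then show ?thesis unfolding interval_dist_def by linarith
  qed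
  have "interval_dist A B \<le> 0"
  proof (rule ccontr)
    assume "\<not> interval_dist A B \<le> 0"
    then show False using close[of "interval_dist A B / 2"] by simp
  qed
  then show ?thesis unfolding interval_dist_def by (intro interval_eqI) auto
qed

text \<open>Riemann sums and the metric act on the two endpoints separately, so the interval integral reduces
to two real delta-integrals.\<close>
lemma IR_integral_eq_endpoint_integrals:
  assumes T: "closed T" "a \<in> T" "b \<in> T" "a \<le> b"
    and l: "l \<in> C_rd T a b" and u: "u \<in> C_rd T a b"
    and F: "\<And>s. s \<in> ts_Icc T a b \<Longrightarrow> lower (F s) = l s \<and> upper (F s) = u s"
  shows "IR_integrable T a b F"
    and "lower (IR_integral T a b F) = delta_integral T a b l"
    and "upper (IR_integral T a b F) = delta_integral T a b u"
proof -
  let ?A = "Interval (delta_integral T a b l, delta_integral T a b u)"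
  have "delta_integral T a b l \<le> delta_integral T a b u"
    unfolding delta_integral_def
  proof (rule integral_le[OF C_rd_last_point_integrable[OF T l] C_rd_last_point_integrable[OF T u]])
    fix x assume "x \<in> {a..b}"
    from F[OF last_point_in_ts_Icc(2)[OF T(1,2) this]]
    show "l (last_point T x) \<le> u (last_point T x)" by (metis lower_le_upper)
  qed
  then have bounds: "lower ?A = delta_integral T a b l" "upper ?A = delta_integral T a b u"
    by (simp_all add: bounds_Interval)
  have A: "has_IR_integral T a b F ?A"
    unfolding has_IR_integral_def
  proof (intro allI impI)
    fix \<epsilon> :: real assume "0 < \<epsilon>"
    obtain \<delta> where \<delta>: "0 < \<delta>" "\<And>n t \<xi>. tagged_fine_division \<delta> T a b n t \<xi> \<Longrightarrow>
        \<bar>(\<Sum>i<n. (t (Suc i) - t i) * l (\<xi> i)) - delta_integral T a b l\<bar> < \<epsilon>"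
      using C_rd_delta_integral[OF T(1,2) l \<open>0 < \<epsilon>\<close>] unfolding delta_integral_def by blast
    obtain \<delta>' where \<delta>': "0 < \<delta>'" "\<And>n t \<xi>. tagged_fine_division \<delta>' T a b n t \<xi> \<Longrightarrow>
        \<bar>(\<Sum>i<n. (t (Suc i) - t i) * u (\<xi> i)) - delta_integral T a b u\<bar> < \<epsilon>"
      using C_rd_delta_integral[OF T(1,2) u \<open>0 < \<epsilon>\<close>] unfolding delta_integral_def by blast
    have "interval_dist (riemann_delta_sum F n t \<xi>) ?A < \<epsilon>"
      if "fine_division (min \<delta> \<delta>') T a b n t" "\<forall>i<n. \<xi> i \<in> ts_Ico T (t i) (t (Suc i))" for n t \<xi>
    proof -
      have tag: "tagged_fine_division \<delta> T a b n t \<xi>" "tagged_fine_division \<delta>' T a b n t \<xi>"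
        using that by (auto simp: tagged_fine_division_def intro: fine_division_mono)
      have t: "ts_division T a b n t" using that(1) by (simp add: fine_division_def)
      have "lower (F (\<xi> i)) = l (\<xi> i)" "upper (F (\<xi> i)) = u (\<xi> i)" if "i < n" for i
        using F[OF tagged_fine_division_tag_in_ts_Icc[OF tag(1) that]] by auto
      then show ?thesis
        using \<delta>(2)[OF tag(1)] \<delta>'(2)[OF tag(2)]
        by (simp add: interval_dist_def bounds_riemann_delta_sum[OF t] bounds)
    qed
    then show "\<exists>\<delta>>0. \<forall>n t \<xi>. fine_division \<delta> T a b n t \<longrightarrow>
        (\<forall>i<n. \<xi> i \<in> ts_Ico T (t i) (t (Suc i))) \<longrightarrow>
        interval_dist (riemann_delta_sum F n t \<xi>) ?A < \<epsilon>"
      using \<delta>(1) \<delta>'(1) by (intro exI[of _ "min \<delta> \<delta>'"]) auto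
  qed
  then show "IR_integrable T a b F" unfolding IR_integrable_def by blast
  have "IR_integral T a b F = ?A"
    unfolding IR_integral_def using A has_IR_integral_unique[OF T _ A] by (rule the_equality)
  then show "lower (IR_integral T a b F) = delta_integral T a b l"
    "upper (IR_integral T a b F) = delta_integral T a b u"
    using bounds by simp_all
qed


section \<open>Minkowski's inequality\<close>

text \<open>Convexity of \<open>x powr p\<close>, applied to
\<open>(x + y) / (\<alpha> + \<beta>)\<close> as the convex combination of \<open>x / \<alpha>\<close> and \<open>y / \<beta>\<close> with weights \<open>\<alpha> / (\<alpha> + \<beta>)\<close> and
\<open>\<beta> / (\<alpha> + \<beta>)\<close>.\<close>
lemma powr_add_le_weighted:
  fixes x y \<alpha> \<beta> p :: real
  assumes "0 < x" "0 < y" "0 < \<alpha>" "0 < \<beta>" "1 \<le> p"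
  shows "(x + y) powr p \<le>
    (\<alpha> + \<beta>) powr p * (\<alpha> / (\<alpha> + \<beta>) * (x powr p / \<alpha> powr p) + \<beta> / (\<alpha> + \<beta>) * (y powr p / \<beta> powr p))"
proof -
  let ?c = "\<beta> / (\<alpha> + \<beta>)"
  have c: "0 \<le> ?c" "?c \<le> 1" "1 - ?c = \<alpha> / (\<alpha> + \<beta>)" using assms by (auto simp: field_simps)
  have "((1 - ?c) *\<^sub>R (x / \<alpha>) + ?c *\<^sub>R (y / \<beta>)) powr p \<le> (1 - ?c) * (x / \<alpha>) powr p + ?c * (y / \<beta>) powr p"
    using assms c(1,2) by (intro convex_onD[OF powr_convex]) auto
  moreover have "(1 - ?c) *\<^sub>R (x / \<alpha>) + ?c *\<^sub>R (y / \<beta>) = (x + y) / (\<alpha> + \<beta>)"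
    unfolding c(3) using assms by (simp add: add_divide_distrib)
  ultimately have "(x + y) powr p / (\<alpha> + \<beta>) powr p \<le>
      \<alpha> / (\<alpha> + \<beta>) * (x powr p / \<alpha> powr p) + ?c * (y powr p / \<beta> powr p)"
    unfolding c(3) using assms by (simp add: powr_divide)
  then show ?thesis using assms by (simp add: divide_le_eq mult.commute)
qed

text \<open>With \<open>\<alpha>\<close> and \<open>\<beta>\<close> the weighted norms of \<open>f\<close> and \<open>g\<close>, the right-hand side of
\<open>powr_add_le_weighted\<close> would integrate to \<open>(\<alpha> + \<beta>) powr p\<close>. But these norms vanish when \<open>w\<close> does, so
each is enlarged by \<open>e / 2\<close> to make the divisions legitimate; the integral is then at most
\<open>(\<alpha> + \<beta>) powr p\<close>, and \<open>e\<close> is arbitrary.\<close>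
lemma Minkowski_weighted_integral:
  fixes w f g :: "real \<Rightarrow> real"
  assumes nonneg: "\<And>x. x \<in> S \<Longrightarrow> 0 \<le> w x" and pos: "\<And>x. x \<in> S \<Longrightarrow> 0 < f x" "\<And>x. x \<in> S \<Longrightarrow> 0 < g x"
    and p: "1 \<le> p"
    and int_f: "(\<lambda>x. w x * f x powr p) integrable_on S"
    and int_g: "(\<lambda>x. w x * g x powr p) integrable_on S"
    and int_fg: "(\<lambda>x. w x * (f x + g x) powr p) integrable_on S"
  shows "integral S (\<lambda>x. w x * (f x + g x) powr p) powr (1 / p)
    \<le> integral S (\<lambda>x. w x * f x powr p) powr (1 / p) + integral S (\<lambda>x. w x * g x powr p) powr (1 / p)"
proof (rule field_le_epsilon)
  fix e :: real assume "0 < e"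
  let ?A = "integral S (\<lambda>x. w x * f x powr p)"
  let ?B = "integral S (\<lambda>x. w x * g x powr p)"
  let ?C = "integral S (\<lambda>x. w x * (f x + g x) powr p)"
  have ABC: "0 \<le> ?A" "0 \<le> ?B" "0 \<le> ?C"
    using nonneg by (auto intro!: integral_nonneg int_f int_g int_fg)
  define \<alpha> where "\<alpha> = ?A powr (1 / p) + e / 2"
  define \<beta> where "\<beta> = ?B powr (1 / p) + e / 2"
  have \<alpha>\<beta>: "0 < \<alpha>" "0 < \<beta>" using \<open>0 < e\<close> by (simp_all add: \<alpha>_def \<beta>_def add_nonneg_pos)
  have "(?A powr (1 / p)) powr p \<le> \<alpha> powr p" "(?B powr (1 / p)) powr p \<le> \<beta> powr p"
    using \<open>0 < e\<close> p by (auto intro!: powr_mono2 simp: \<alpha>_def \<beta>_def)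
  then have "?A \<le> \<alpha> powr p" "?B \<le> \<beta> powr p"
    using p ABC by (simp_all add: powr_powr)
  then have le1: "?A / \<alpha> powr p \<le> 1" "?B / \<beta> powr p \<le> 1" using \<alpha>\<beta> by simp_all
  let ?a = "(\<alpha> + \<beta>) powr p * (\<alpha> / (\<alpha> + \<beta>) / \<alpha> powr p)"
  let ?b = "(\<alpha> + \<beta>) powr p * (\<beta> / (\<alpha> + \<beta>) / \<beta> powr p)"
  have "?C \<le> integral S (\<lambda>x. ?a * (w x * f x powr p) + ?b * (w x * g x powr p))"
  proof (rule integral_le[OF int_fg])
    show "(\<lambda>x. ?a * (w x * f x powr p) + ?b * (w x * g x powr p)) integrable_on S"
      by (intro integrable_add integrable_on_mult_right int_f int_g)
    fix x assume x: "x \<in> S"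
    from mult_left_mono[OF powr_add_le_weighted[OF pos[OF x] \<alpha>\<beta> p] nonneg[OF x]]
    show "w x * (f x + g x) powr p \<le> ?a * (w x * f x powr p) + ?b * (w x * g x powr p)"
      by (simp add: algebra_simps)
  qed
  also have "\<dots> = ?a * ?A + ?b * ?B"
    by (intro integral_unique has_integral_add has_integral_mult_right integrable_integral int_f int_g)
  also have "\<dots> = (\<alpha> + \<beta>) powr p * (\<alpha> / (\<alpha> + \<beta>) * (?A / \<alpha> powr p) + \<beta> / (\<alpha> + \<beta>) * (?B / \<beta> powr p))"
    by (simp add: algebra_simps)
  also have "\<dots> \<le> (\<alpha> + \<beta>) powr p * (\<alpha> / (\<alpha> + \<beta>) * 1 + \<beta> / (\<alpha> + \<beta>) * 1)"
    using \<alpha>\<beta> le1 by (intro mult_left_mono add_mono) auto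
  also have "\<dots> = (\<alpha> + \<beta>) powr p" using \<alpha>\<beta> by (simp flip: add_divide_distrib)
  finally have "?C powr (1 / p) \<le> ((\<alpha> + \<beta>) powr p) powr (1 / p)"
    using p ABC by (intro powr_mono2) auto
  also have "\<dots> = \<alpha> + \<beta>" using \<alpha>\<beta> p by (simp add: powr_powr)
  finally show "?C powr (1 / p) \<le> ?A powr (1 / p) + ?B powr (1 / p) + e"
    by (simp add: \<alpha>_def \<beta>_def)
qed

lemma C_rd_abs_mult_powr:
  assumes "h \<in> C_rd T a b" "continuous_on (ts_Icc T a b) k" "\<And>s. s \<in> ts_Icc T a b \<Longrightarrow> 0 < k s"
  shows "(\<lambda>s. \<bar>h s\<bar> * k s powr p) \<in> C_rd T a b"
  using assms by (intro C_rd_mult_continuous C_rd_abs continuous_on_powr continuous_on_const) force+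

lemma delta_integral_Minkowski:
  assumes T: "closed T" "a \<in> T" "b \<in> T" "a \<le> b" and h: "h \<in> C_rd T a b"
    and f: "continuous_on (ts_Icc T a b) f" "\<And>s. s \<in> ts_Icc T a b \<Longrightarrow> 0 < f s"
    and g: "continuous_on (ts_Icc T a b) g" "\<And>s. s \<in> ts_Icc T a b \<Longrightarrow> 0 < g s"
    and p: "1 \<le> p"
  shows "delta_integral T a b (\<lambda>s. \<bar>h s\<bar> * (f s + g s) powr p) powr (1 / p)
    \<le> delta_integral T a b (\<lambda>s. \<bar>h s\<bar> * f s powr p) powr (1 / p)
      + delta_integral T a b (\<lambda>s. \<bar>h s\<bar> * g s powr p) powr (1 / p)"
  unfolding delta_integral_def
proof (rule Minkowski_weighted_integral)
  note mem = last_point_in_ts_Icc(2)[OF T(1,2)]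
  show "0 < f (last_point T x)" "0 < g (last_point T x)" if "x \<in> {a..b}" for x
    using f(2) g(2) mem[OF that] by auto
  show "(\<lambda>x. \<bar>h (last_point T x)\<bar> * f (last_point T x) powr p) integrable_on {a..b}"
    by (rule C_rd_last_point_integrable[OF T C_rd_abs_mult_powr[OF h f]])
  show "(\<lambda>x. \<bar>h (last_point T x)\<bar> * g (last_point T x) powr p) integrable_on {a..b}"
    by (rule C_rd_last_point_integrable[OF T C_rd_abs_mult_powr[OF h g]])
  have fg: "continuous_on (ts_Icc T a b) (\<lambda>s. f s + g s)" "\<And>s. s \<in> ts_Icc T a b \<Longrightarrow> 0 < f s + g s"
    using f g by (auto intro: continuous_on_add add_pos_pos)
  show "(\<lambda>x. \<bar>h (last_point T x)\<bar> * (f (last_point T x) + g (last_point T x)) powr p) integrable_on {a..b}"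
    by (rule C_rd_last_point_integrable[OF T C_rd_abs_mult_powr[OF h fg]])
qed (use p in auto)

lemma C_interval_endpoints:
  assumes "f \<in> C_interval T a b pos_intervals"
  shows "continuous_on (ts_Icc T a b) (\<lambda>s. lower (f s))" "continuous_on (ts_Icc T a b) (\<lambda>s. upper (f s))"
    and "\<And>s. s \<in> ts_Icc T a b \<Longrightarrow> 0 < lower (f s)" "\<And>s. s \<in> ts_Icc T a b \<Longrightarrow> 0 < upper (f s)"
proof -
  have *: "\<exists>\<delta>>0. \<forall>s\<in>ts_Icc T a b. \<bar>s - t\<bar> < \<delta> \<longrightarrow>
      \<bar>lower (f s) - lower (f t)\<bar> < \<epsilon> \<and> \<bar>upper (f s) - upper (f t)\<bar> < \<epsilon>"
    if "t \<in> ts_Icc T a b" "0 < \<epsilon>" for t \<epsilon>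
    using assms that unfolding C_interval_def interval_dist_def by fastforce
  show "continuous_on (ts_Icc T a b) (\<lambda>s. lower (f s))" "continuous_on (ts_Icc T a b) (\<lambda>s. upper (f s))"
    unfolding continuous_on_iff dist_real_def using * by meson+
  show lower: "0 < lower (f s)" if "s \<in> ts_Icc T a b" for s
    using assms that by (auto simp: C_interval_def pos_intervals_def)
  show "0 < upper (f s)" if "s \<in> ts_Icc T a b" for s
    using lower[OF that] lower_le_upper by (rule less_le_trans)
qed

lemma IR_integral_weighted_powr:
  assumes T: "closed T" "a \<in> T" "b \<in> T" "a \<le> b" and h: "h \<in> C_rd T a b" and "0 < p"
    and k: "continuous_on (ts_Icc T a b) (\<lambda>s. lower (k s))" "continuous_on (ts_Icc T a b) (\<lambda>s. upper (k s))"
    and pos: "\<And>s. s \<in> ts_Icc T a b \<Longrightarrow> 0 < lower (k s)"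
  shows "IR_integrable T a b (\<lambda>s. interval_scale \<bar>h s\<bar> (interval_powr (k s) p))"
    and "lower (IR_integral T a b (\<lambda>s. interval_scale \<bar>h s\<bar> (interval_powr (k s) p)))
      = delta_integral T a b (\<lambda>s. \<bar>h s\<bar> * lower (k s) powr p)"
    and "upper (IR_integral T a b (\<lambda>s. interval_scale \<bar>h s\<bar> (interval_powr (k s) p)))
      = delta_integral T a b (\<lambda>s. \<bar>h s\<bar> * upper (k s) powr p)"
    and "0 \<le> lower (IR_integral T a b (\<lambda>s. interval_scale \<bar>h s\<bar> (interval_powr (k s) p)))"
proof -
  have pos': "0 < upper (k s)" if "s \<in> ts_Icc T a b" for s
    using pos[OF that] lower_le_upper by (rule less_le_trans)
  note l = C_rd_abs_mult_powr[OF h k(1) pos, of p] and u = C_rd_abs_mult_powr[OF h k(2) pos', of p]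
  note * = IR_integral_eq_endpoint_integrals[OF T l u,
    of "\<lambda>s. interval_scale \<bar>h s\<bar> (interval_powr (k s) p)"]
  show "IR_integrable T a b (\<lambda>s. interval_scale \<bar>h s\<bar> (interval_powr (k s) p))"
    and lower: "lower (IR_integral T a b (\<lambda>s. interval_scale \<bar>h s\<bar> (interval_powr (k s) p)))
      = delta_integral T a b (\<lambda>s. \<bar>h s\<bar> * lower (k s) powr p)"
    and "upper (IR_integral T a b (\<lambda>s. interval_scale \<bar>h s\<bar> (interval_powr (k s) p)))
      = delta_integral T a b (\<lambda>s. \<bar>h s\<bar> * upper (k s) powr p)"
    by (rule *; use pos \<open>0 < p\<close> in \<open>simp add: bounds_interval_scale bounds_interval_powr less_imp_le\<close>)+
  show "0 \<le> lower (IR_integral T a b (\<lambda>s. interval_scale \<bar>h s\<bar> (interval_powr (k s) p)))"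
    unfolding lower delta_integral_def
    by (intro integral_nonneg C_rd_last_point_integrable[OF T l] mult_nonneg_nonneg) simp_all
qed

theorem theorem16:
  fixes T :: "real set" and a b p :: real
    and h :: "real \<Rightarrow> real" and f g :: "real \<Rightarrow> real interval"
  assumes "time_scale T" and "a \<in> T" and "b \<in> T" and "a < b"
    and "h \<in> C_rd T a b"
    and "f \<in> C_interval T a b pos_intervals"
    and "g \<in> C_interval T a b pos_intervals"
    and "p > 1"
  shows "IR_integrable T a b (\<lambda>s. interval_scale \<bar>h s\<bar> (interval_powr (f s + g s) p)) \<and>
    IR_integrable T a b (\<lambda>s. interval_scale \<bar>h s\<bar> (interval_powr (f s) p)) \<and>
    IR_integrable T a b (\<lambda>s. interval_scale \<bar>h s\<bar> (interval_powr (g s) p)) \<and>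
    interval_powr (IR_integral T a b
        (\<lambda>s. interval_scale \<bar>h s\<bar> (interval_powr (f s + g s) p))) (1 / p)
      \<le>\<^sub>I interval_powr (IR_integral T a b
            (\<lambda>s. interval_scale \<bar>h s\<bar> (interval_powr (f s) p))) (1 / p)
         + interval_powr (IR_integral T a b
            (\<lambda>s. interval_scale \<bar>h s\<bar> (interval_powr (g s) p))) (1 / p)"
proof -
  have T: "closed T" "a \<in> T" "b \<in> T" "a \<le> b"
    using assms by (auto simp: time_scale_def)
  have p: "1 \<le> p" "0 < p" using \<open>p > 1\<close> by auto
  note h = \<open>h \<in> C_rd T a b\<close>
  note f = C_interval_endpoints[OF \<open>f \<in> C_interval T a b pos_intervals\<close>]
  note g = C_interval_endpoints[OF \<open>g \<in> C_interval T a b pos_intervals\<close>]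
  have fg: "continuous_on (ts_Icc T a b) (\<lambda>s. lower (f s + g s))"
      "continuous_on (ts_Icc T a b) (\<lambda>s. upper (f s + g s))"
      "\<And>s. s \<in> ts_Icc T a b \<Longrightarrow> 0 < lower (f s + g s)"
    using f g by (auto intro: continuous_on_add add_pos_pos)
  note If = IR_integral_weighted_powr[OF T h p(2) f(1-3)]
  note Ig = IR_integral_weighted_powr[OF T h p(2) g(1-3)]
  note Ifg = IR_integral_weighted_powr[OF T h p(2) fg]
  show ?thesis
    unfolding interval_le_def lower_plus upper_plus
    using If(1,4) Ig(1,4) Ifg(1,4) p delta_integral_Minkowski[OF T h f(1,3) g(1,3) p(1)]
      delta_integral_Minkowski[OF T h f(2,4) g(2,4) p(1)]
    by (simp add: bounds_interval_powr If(2,3) Ig(2,3) Ifg(2,3))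
qed

end
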